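(* Let $N\ge1$, $d=2^N$, and let $|\psi\rangle\langle\psi|_{\tilde A\tilde A'}$ be any pure fermionic state of $N+N$ modes. Let $\omega^f_{noise}$ be an $N\times N$-mode fermionic state on $AB$ of the form $$\omega^f_{noise}=(1-F_f)\left(\frac{\mathbb I_N\wedge\mathbb I_N}{d^2}+\Upsilon_1\frac{\mathbb S_z\wedge\mathbb S_z}{d^2}\right)+F_f\,\omega^f_{AB},\qquad \omega^f_{AB}=\text{loc-p}(|\psi^+\rangle\langle\psi^+|_f)+\Upsilon\,\overline{\text{loc-p}}(|\psi^+\rangle\langle\psi^+|_f),$$ with real $F_f,\Upsilon,\Upsilon_1$, $-1\le\Upsilon_1\le1$. Then the output state of the fermionic teleportation protocol (Bell measurement by Alice on $\tilde AA$, classical communication, unitary correction by Bob on $B$) with shared resource $\omega^f_{noise}$ is $$\rho^f_{B\tilde A'}=(1-F_f)\left(\frac{\mathbb I_N\wedge\rho^f_{\tilde A'}}{d}\pm\Upsilon_1\frac{(\mathbb I_N\wedge\rho^f_{\tilde A'})(\mathbb S_z\wedge\mathbb S_z)}{d}\right)+F_f\left(\text{loc-p}(|\psi\rangle\langle\psi|_{B\tilde A'})+\Upsilon\,\overline{\text{loc-p}}(|\psi\rangle\langle\psi|_{B\tilde A'})\right),$$ where the sign is $+$ if $|\psi\rangle$ has even parity and $-$ if it has odd parity, $\rho^f_{\tilde A'}$ is the reduced state of $|\psi\rangle\langle\psi|_{\tilde A\tilde A'}$ on $\tilde A'$, and $|\psi\rangle_{B\tilde A'}$ is $|\psi\rangle_{\tilde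 A\tilde A'}$ with the modes of $\tilde A$ replaced by those of $B$.
   Context: Fermionic setting. An $N$-mode fermionic system has the $d=2^N$ dimensional Fock space with orthonormal occupation-number basis $f_{j_1}^\dagger\cdots f_{j_k}^\dagger|\Omega\rangle$ ($j_1<\dots<j_k$). The basis vectors with $k$ even are denoted $|E_1\rangle,\dots,|E_{d/2}\rangle$ and those with $k$ odd $|O_1\rangle,\dots,|O_{d/2}\rangle$. An operator is block-diagonal (BD) if it lies in the span of the $|E_i\rangle\langle E_j|$, $|O_i\rangle\langle O_j|$, and anti-block-diagonal (ABD) if it lies in the span of the $|E_i\rangle\langle O_j|$, $|O_i\rangle\langle E_j|$. For a composite system $XY$, the vectors $|x\rangle\wedge|y\rangle$ (creation operators of $X$ to the left of those of $Y$, applied to the vacuum) form an orthonormal basis; $\langle x|\wedge\langle y|$ is the bra dual to $|x\rangle\wedge|y\rangle$; and the wedge product of operators is the bilinear extension of $|x\rangle\langle x'|\wedge|y\rangle\langle y'|=(|x\rangle\wedge|y\rangle)(\langle x'|\wedge\langle y'|)$ (iterated for more factors). A fermionic state is a density operator commuting with total fermion parity (parity superselection rule); thus a pure fermionic state has definite (even or odd) total parity. Partial traces are fermionic: the reduced state is the parity-respecting operator giving the same expectation values for observables of the remaining modes. Notation. $\mathbb I_N$ is the identity on $N$ modes and $\mathbb S_z=\sum_k(|E_k\rangle\langle E_k|-|O_k\rangle\langle O_k|)$. $|\psi^+\rangle_f=\frac1{\sqrt d}\sum_i(|E_i\rangle\wedge|E_i\rangle+|O_i\rangle\wedge|O_i\rangle)$.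 For an operator $X$ on a bipartite system, $\text{loc-p}(X)=\sum_{s,t\in\{E,O\}}(\Pi_s\wedge\Pi_t)X(\Pi_s\wedge\Pi_t)$ is its local-parity preserving part, $\Pi_E,\Pi_O$ being the projectors on the even and odd subspaces of $N$ modes, and $\overline{\text{loc-p}}(X)=X-\text{loc-p}(X)$ is its local-parity violating part. Protocol. All of $\tilde A,\tilde A',A,B$ have $N$ modes. The initial state is $|\psi\rangle\langle\psi|_{\tilde A\tilde A'}\wedge(\omega^f_{noise})_{AB}$. Let $U_x$ ($d^2$ values of $x=(p,q)$, $0\le p,q\le d-1$) be the Weyl unitaries $U_{pq}=\sum_{k=0}^{d-1}e^{2\pi ipk/d}|k\rangle\langle(k+q)\bmod d|$, where $|k\rangle$ with $k$ even enumerate the even basis vectors $|E_i\rangle$ and $|k\rangle$ with $k$ odd enumerate the odd basis vectors $|O_i\rangle$ (so each $U_x$ is BD or ABD). Alice measures $\tilde AA$ with the projectors $M_x=(U_x\wedge\mathbb I)|\psi^+\rangle\langle\psi^+|_f(U_x^\dagger\wedge\mathbb I)$ and sends the outcome $x$ to Bob, who applies $U_x$ to $B$. The modes are reordered from $\tilde A\tilde A'AB$ to $\tilde AAB\tilde A'$ using the anticommutation relations, and the output is $$\rho^f_{B\tilde A'}=\sum_x(U_x\wedge\mathbb I_{\tilde A'})\,\mathrm{tr}_{\tilde AA}\big[(|\psi\rangle\langle\psi|_{\tilde A\tilde A'}\wedge(\omega^f_{noise})_{AB})(M_x\wedge\mathbb I_B\wedge\mathbb I_{\tilde A'})\big](U_x^\dagger\wedge\mathbb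 I_{\tilde A'}).$$ *)

theory Defs
  imports "HOL-Analysis.Analysis"
begin

section \<open>Kets and operators in an occupation-number basis\<close>

text \<open>
  A system with mode type \<open>'n\<close> has the occupation-number basis \<open>'n set\<close>; the set
  \<open>{j\<^sub>1 < \<dots> < j\<^sub>k}\<close> stands for \<open>f\<^sup>\<dagger>(j\<^sub>1) \<cdots> f\<^sup>\<dagger>(j\<^sub>k)\<close> applied to the vacuum.
  A composite system \<open>XY\<close> is described in its wedge basis: the pair \<open>(x, y)\<close> stands for the ket
  \<open>|x\<rangle> \<and> |y\<rangle>\<close>.  Hence the order of the components of an index type is the order of the
  subsystems, and changing this order is a non-trivial change of basis (see \<open>reorder\<close> below).
\<close>

class occupation = finite +
  fixes fermion_number :: "'a \<Rightarrow> nat"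

instantiation set :: (finite) occupation
begin
definition "fermion_number (x :: 'a set) = card x"
instance ..
end

instantiation prod :: (occupation, occupation) occupation
begin
definition "fermion_number (p :: 'a \<times> 'b) = fermion_number (fst p) + fermion_number (snd p)"
instance ..
end

type_synonym 'a ket = "complex ^ 'a"
type_synonym 'a oper = "complex ^ 'a ^ 'a"

definition ket :: "'a::finite \<Rightarrow> 'a ket" where
  "ket x = axis x 1"

definition ketbra :: "'a::finite ket \<Rightarrow> 'a ket \<Rightarrow> 'a oper" where
  "ketbra u v = (\<chi> i j. u $ i * cnj (v $ j))"

definition dagger :: "'a::finite oper \<Rightarrow> 'a oper" where
  "dagger A = (\<chi> i j. cnj (A $ j $ i))"

definition wedge_ket :: "'a::finite ket \<Rightarrow> 'b::finite ket \<Rightarrow> ('a \<times> 'b) ket"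
    (infixr "\<and>\<^sub>k" 75) where
  "u \<and>\<^sub>k v = (\<chi> p. u $ fst p * v $ snd p)"

definition wedge :: "'a::finite oper \<Rightarrow> 'b::finite oper \<Rightarrow> ('a \<times> 'b) oper"
    (infixr "\<and>\<^sub>f" 75) where
  "A \<and>\<^sub>f B = (\<chi> p q. A $ fst p $ fst q * B $ snd p $ snd q)"

abbreviation ident :: "'a::finite oper" ("\<I>") where
  "\<I> \<equiv> mat 1"


section \<open>Parity\<close>

datatype parity = Even | Odd

fun sector :: "parity \<Rightarrow> 'a::occupation set" where
  "sector Even = {x. even (fermion_number x)}"
| "sector Odd = {x. odd (fermion_number x)}"

definition sector_proj :: "parity \<Rightarrow> 'a::occupation oper" where
  "sector_proj s = (\<Sum>x\<in>sector s. ketbra (ket x) (ket x))"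

text \<open>On a composite system \<open>\<S>\<close> is the total fermion parity.\<close>

definition Sz :: "'a::occupation oper" ("\<S>") where
  "\<S> = (\<Sum>x\<in>sector Even. ketbra (ket x) (ket x)) - (\<Sum>x\<in>sector Odd. ketbra (ket x) (ket x))"

definition parity_respecting :: "'a::occupation oper \<Rightarrow> bool" where
  "parity_respecting A \<longleftrightarrow> A ** \<S> = \<S> ** A"

definition even_ket :: "'a::occupation ket \<Rightarrow> bool" where
  "even_ket v \<longleftrightarrow> \<S> *v v = v"

definition odd_ket :: "'a::occupation ket \<Rightarrow> bool" where
  "odd_ket v \<longleftrightarrow> \<S> *v v = - v"

definition density_operator :: "'a::finite oper \<Rightarrow> bool" where
  "density_operator \<rho> \<longleftrightarrow>
     (\<forall>v. (\<Sum>i\<in>UNIV. cnj (v $ i) * (\<rho> *v v) $ i) \<in> \<real>\<^sub>\<ge>\<^sub>0) \<and> trace \<rho> = 1"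

definition fermionic_state :: "'a::occupation oper \<Rightarrow> bool" where
  "fermionic_state \<rho> \<longleftrightarrow> density_operator \<rho> \<and> parity_respecting \<rho>"

definition loc_p :: "('a::occupation \<times> 'b::occupation) oper \<Rightarrow> ('a \<times> 'b) oper" where
  "loc_p X = (\<Sum>s\<in>{Even, Odd}. \<Sum>t\<in>{Even, Odd}.
     (sector_proj s \<and>\<^sub>f sector_proj t) ** X ** (sector_proj s \<and>\<^sub>f sector_proj t))"

definition loc_p_bar :: "('a::occupation \<times> 'b::occupation) oper \<Rightarrow> ('a \<times> 'b) oper" where
  "loc_p_bar X = X - loc_p X"


section \<open>Fermionic partial trace\<close>

definition observable :: "'a::occupation oper \<Rightarrow> bool" where
  "observable Q \<longleftrightarrow> dagger Q = Q \<and> parity_respecting Q"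

text \<open>Trace over the left subsystem; existence and uniqueness are shown below.\<close>

definition ptrace_left :: "('a::occupation \<times> 'b::occupation) oper \<Rightarrow> 'b oper" where
  "ptrace_left \<rho> = (THE \<sigma>. parity_respecting \<sigma> \<and>
     (\<forall>Q. observable Q \<longrightarrow> trace (\<sigma> ** Q) = trace (\<rho> ** (\<I> \<and>\<^sub>f Q))))"


section \<open>Creation operators and reordering of subsystems\<close>

definition create :: "'n::{finite,linorder} \<Rightarrow> 'n set oper" where
  "create j = (\<chi> x y. if j \<notin> y \<and> x = insert j y then (-1) ^ card {i\<in>y. i < j} else 0)"

text \<open>
  Creation operators of the left and of the right part of a composite system.  On the right part
  the operator has to be moved past the creation operators of the left part, hence the parity
  operator.
\<close>

definition on_left :: "('n \<Rightarrow> 'a::finite oper) \<Rightarrow> 'n \<Rightarrow> ('a \<times> 'b::finite) oper" where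
  "on_left c j = c j \<and>\<^sub>f \<I>"

definition on_right :: "('n \<Rightarrow> 'b::finite oper) \<Rightarrow> 'n \<Rightarrow> ('a::occupation \<times> 'b) oper" where
  "on_right c j = \<S> \<and>\<^sub>f c j"

text \<open>The product \<open>c j\<^sub>1 \<cdots> c j\<^sub>k\<close> for \<open>x = {j\<^sub>1 < \<dots> < j\<^sub>k}\<close>.\<close>

definition creation_string :: "('n::{finite,linorder} \<Rightarrow> 'a::finite oper) \<Rightarrow> 'n set \<Rightarrow> 'a oper" where
  "creation_string c x = foldr (\<lambda>j A. c j ** A) (sorted_list_of_set x) \<I>"

text \<open>
  The input state lives on \<open>C C'\<close> and the shared resource on \<open>A B\<close>.  Below is the ket
  \<open>|a\<rangle> \<and> |x\<rangle> \<and> |b\<rangle> \<and> |a'\<rangle>\<close> of the subsystem order \<open>C A B C'\<close>, as an element of the Fock space of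
  \<open>C C' A B\<close>, whose creation operators are those of \<open>on_left\<close> and \<open>on_right\<close>.
\<close>

type_synonym 'n four = "('n set \<times> 'n set) \<times> ('n set \<times> 'n set)"

definition reordered_ket :: "'n::{finite,linorder} four \<Rightarrow> 'n four ket" where
  "reordered_ket = (\<lambda>((a, x), (b, a')).
     (creation_string (on_left (on_left create)) a **
      creation_string (on_right (on_left create)) x **
      creation_string (on_right (on_right create)) b **
      creation_string (on_left (on_right create)) a') *v ket (({}, {}), ({}, {})))"

text \<open>
  Matrix elements in the wedge basis of order \<open>C A B C'\<close> of an operator given in the wedge basis
  of order \<open>C C' A B\<close>.
\<close>

definition reorder :: "'n::{finite,linorder} four oper \<Rightarrow> 'n four oper" where
  "reorder \<rho> = (\<chi> p q. \<Sum>i\<in>UNIV. cnj (reordered_ket p $ i) * (\<rho> *v reordered_ket q) $ i)"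


section \<open>The teleportation protocol\<close>

text \<open>Here \<open>d = 2 ^ CARD('n)\<close> is the dimension of the Fock space of one system.\<close>

definition psi_plus :: "('n::finite set \<times> 'n set) ket" where
  "psi_plus = (1 / sqrt (2 ^ CARD('n))) *\<^sub>R
     ((\<Sum>x\<in>sector Even. ket x \<and>\<^sub>k ket x) + (\<Sum>x\<in>sector Odd. ket x \<and>\<^sub>k ket x))"

definition basis_enumeration :: "(nat \<Rightarrow> 'n::finite set) \<Rightarrow> bool" where
  "basis_enumeration \<kappa> \<longleftrightarrow> bij_betw \<kappa> {..<2 ^ CARD('n)} UNIV \<and>
     (\<forall>k < 2 ^ CARD('n). \<kappa> k \<in> sector (if even k then Even else Odd))"

definition weyl :: "(nat \<Rightarrow> 'n::finite set) \<Rightarrow> nat \<Rightarrow> nat \<Rightarrow> 'n set oper" where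
  "weyl \<kappa> p q = (\<Sum>k<2 ^ CARD('n).
     ketbra (exp (2 * of_real pi * \<i> * of_nat p * of_nat k / 2 ^ CARD('n)) *s ket (\<kappa> k))
            (ket (\<kappa> ((k + q) mod 2 ^ CARD('n)))))"

definition bell_proj :: "(nat \<Rightarrow> 'n::finite set) \<Rightarrow> nat \<Rightarrow> nat \<Rightarrow> ('n set \<times> 'n set) oper" where
  "bell_proj \<kappa> p q =
     (weyl \<kappa> p q \<and>\<^sub>f \<I>) ** ketbra psi_plus psi_plus ** (dagger (weyl \<kappa> p q) \<and>\<^sub>f \<I>)"

definition teleport_output ::
    "(nat \<Rightarrow> 'n::{finite,linorder} set) \<Rightarrow> ('n set \<times> 'n set) ket \<Rightarrow> ('n set \<times> 'n set) oper
      \<Rightarrow> ('n set \<times> 'n set) oper" where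
  "teleport_output \<kappa> \<psi> \<omega> = (\<Sum>p<2 ^ CARD('n). \<Sum>q<2 ^ CARD('n).
     (weyl \<kappa> p q \<and>\<^sub>f \<I>) **
     ptrace_left (reorder (ketbra \<psi> \<psi> \<and>\<^sub>f \<omega>) ** (bell_proj \<kappa> p q \<and>\<^sub>f \<I> \<and>\<^sub>f \<I>)) **
     (dagger (weyl \<kappa> p q) \<and>\<^sub>f \<I>))"


section \<open>Basic facts\<close>

lemma Sz_nth: "(\<S> :: 'a::occupation oper) $ x $ y = (if x = y then (-1) ^ fermion_number x else 0)"
proof -
  have *: "(\<Sum>z\<in>A. ketbra (ket z) (ket z)) $ x $ y = (if x = y \<and> x \<in> A then 1 else 0)"
    for A :: "'a set"
  proof -
    have "(\<Sum>z\<in>A. ketbra (ket z) (ket z)) $ x $ y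
        = (\<Sum>z\<in>A. if x = z then (if x = y then 1 else 0) else 0)"
      unfolding sum_component
      by (intro sum.cong refl) (auto simp: ketbra_def ket_def axis_def)
    also have "\<dots> = (if x = y \<and> x \<in> A then 1 else 0)"
      by (subst sum.delta') auto
    finally show ?thesis .
  qed
  show ?thesis
    unfolding Sz_def vector_minus_component * by auto
qed

lemma Sz_mult_left: "((\<S> :: 'a::occupation oper) ** A) $ x $ y = (-1) ^ fermion_number x * A $ x $ y"
proof -
  have "(\<S> ** A) $ x $ y = (\<Sum>k\<in>UNIV. if x = k then (-1) ^ fermion_number x * A $ k $ y else 0)"
    unfolding matrix_matrix_mult_def vec_lambda_beta
    by (intro sum.cong refl) (simp add: Sz_nth)
  then show ?thesis by (simp add: sum.delta')
qed

lemma Sz_mult_right: "(A ** (\<S> :: 'a::occupation oper)) $ x $ y = (-1) ^ fermion_number y * A $ x $ y"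
proof -
  have "(A ** \<S>) $ x $ y = (\<Sum>k\<in>UNIV. if k = y then (-1) ^ fermion_number y * A $ x $ k else 0)"
    unfolding matrix_matrix_mult_def vec_lambda_beta
    by (intro sum.cong refl) (simp add: Sz_nth)
  then show ?thesis by (simp add: sum.delta)
qed

lemma Sz_mult_ket: "((\<S> :: 'a::occupation oper) *v v) $ x = (-1) ^ fermion_number x * v $ x"
proof -
  have "(\<S> *v v) $ x = (\<Sum>k\<in>UNIV. if x = k then (-1) ^ fermion_number x * v $ k else 0)"
    unfolding matrix_vector_mult_def vec_lambda_beta
    by (intro sum.cong refl) (simp add: Sz_nth)
  then show ?thesis by (simp add: sum.delta')
qed

lemma parity_respecting_iff:
  fixes A :: "'a::occupation oper"
  shows "parity_respecting A \<longleftrightarrow>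
    (\<forall>x y. even (fermion_number x) \<noteq> even (fermion_number y) \<longrightarrow> A $ x $ y = 0)"
proof -
  have "(-1) ^ m * z = (-1) ^ n * z \<longleftrightarrow> (even m \<noteq> even n \<longrightarrow> z = 0)" for m n and z :: complex
    by (cases "even m"; cases "even n") auto
  then show ?thesis
    by (auto simp: parity_respecting_def vec_eq_iff Sz_mult_left Sz_mult_right)
qed

lemma wedge_ket_ket: "ket x \<and>\<^sub>k ket y = ket (x, y)"
  by (auto simp: wedge_ket_def ket_def axis_def vec_eq_iff)

lemma wedge_ketbra: "ketbra u u' \<and>\<^sub>f ketbra v v' = ketbra (u \<and>\<^sub>k v) (u' \<and>\<^sub>k v')"
  by (simp add: wedge_def ketbra_def wedge_ket_def vec_eq_iff mult_ac)

lemma wedge_mult: "(A \<and>\<^sub>f B) ** (C \<and>\<^sub>f D) = (A ** C) \<and>\<^sub>f (B ** D)"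
proof -
  have "((A \<and>\<^sub>f B) ** (C \<and>\<^sub>f D)) $ p $ q = ((A ** C) \<and>\<^sub>f (B ** D)) $ p $ q" for p q
    by (simp add: matrix_matrix_mult_def wedge_def sum_product sum.cartesian_product
        UNIV_Times_UNIV[symmetric] case_prod_beta mult_ac del: UNIV_Times_UNIV)
  then show ?thesis by (simp add: vec_eq_iff)
qed

lemma wedge_mult_ket: "(A \<and>\<^sub>f B) *v (u \<and>\<^sub>k v) = (A *v u) \<and>\<^sub>k (B *v v)"
proof -
  have "((A \<and>\<^sub>f B) *v (u \<and>\<^sub>k v)) $ p = ((A *v u) \<and>\<^sub>k (B *v v)) $ p" for p
    by (simp add: matrix_vector_mult_def wedge_def wedge_ket_def sum_product sum.cartesian_product
        UNIV_Times_UNIV[symmetric] case_prod_beta mult_ac del: UNIV_Times_UNIV)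
  then show ?thesis by (simp add: vec_eq_iff)
qed

lemma wedge_Id: "(\<I> :: 'a::finite oper) \<and>\<^sub>f (\<I> :: 'b::finite oper) = \<I>"
  by (auto simp: vec_eq_iff wedge_def mat_def)

lemma wedge_Sz: "(\<S> :: 'a::occupation oper) \<and>\<^sub>f (\<S> :: 'b::occupation oper) = \<S>"
  by (auto simp: vec_eq_iff wedge_def Sz_nth fermion_number_prod_def power_add)

text \<open>A pure fermionic state is either even or odd.\<close>

lemma pure_state_parity:
  assumes "fermionic_state (ketbra \<psi> \<psi>)"
  shows "even_ket \<psi> \<noteq> odd_ket \<psi>"
proof -
  have pr: "\<psi> $ x * cnj (\<psi> $ y) = 0"
    if "even (fermion_number x) \<noteq> even (fermion_number y)" for x y
    using assms that by (auto simp: fermionic_state_def parity_respecting_iff ketbra_def)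
  have "\<exists>x. \<psi> $ x \<noteq> 0"
  proof (rule ccontr)
    assume "\<not> ?thesis"
    then have "trace (ketbra \<psi> \<psi>) = 0" by (simp add: trace_def ketbra_def)
    with assms show False by (simp add: fermionic_state_def density_operator_def)
  qed
  then obtain x where x: "\<psi> $ x \<noteq> 0" by blast
  have z: "\<psi> $ y = 0" if "even (fermion_number x) \<noteq> even (fermion_number y)" for y
    using pr[OF that] x by simp
  show ?thesis
  proof (cases "even (fermion_number x)")
    case True
    have "even_ket \<psi>"
      unfolding even_ket_def vec_eq_iff Sz_mult_ket using z True by (metis mult_1 mult_zero_right
          power_minus_even power_one)
    moreover have "\<not> odd_ket \<psi>"
      unfolding odd_ket_def vec_eq_iff Sz_mult_ket using x True
      by (auto intro!: exI[of _ x])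
    ultimately show ?thesis by simp
  next
    case False
    have "(-1) ^ fermion_number y * \<psi> $ y = - \<psi> $ y" for y
      using z[of y] False by (cases "even (fermion_number y)") auto
    then have "odd_ket \<psi>"
      unfolding odd_ket_def vec_eq_iff Sz_mult_ket by simp
    moreover have "\<not> even_ket \<psi>"
      unfolding even_ket_def vec_eq_iff Sz_mult_ket using x False
      by (auto intro!: exI[of _ x])
    ultimately show ?thesis by simp
  qed
qed


subsection \<open>Existence and uniqueness of the partial trace\<close>

lemma trace_mult: "trace (A ** B) = (\<Sum>i\<in>UNIV. \<Sum>j\<in>UNIV. A $ i $ j * B $ j $ i)"
  for A B :: "'a::finite oper"
  by (simp add: trace_def matrix_matrix_mult_def)

lemma trace_mult_Id_wedge:
  fixes \<rho> :: "('a::finite \<times> 'b::finite) oper"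
  shows "trace (\<rho> ** (\<I> \<and>\<^sub>f Q)) = (\<Sum>y\<in>UNIV. \<Sum>y'\<in>UNIV. (\<Sum>x\<in>UNIV. \<rho> $ (x, y) $ (x, y')) * Q $ y' $ y)"
proof -
  have "trace (\<rho> ** (\<I> \<and>\<^sub>f Q))
      = (\<Sum>x\<in>UNIV. \<Sum>y\<in>UNIV. \<Sum>x'\<in>UNIV. \<Sum>y'\<in>UNIV. \<rho> $ (x, y) $ (x', y') * ((if x' = x then 1 else 0) * Q $ y' $ y))"
    by (simp add: trace_mult wedge_def mat_def UNIV_Times_UNIV[symmetric] sum.cartesian_product'
        del: UNIV_Times_UNIV)
  also have "\<dots> = (\<Sum>x\<in>UNIV. \<Sum>y\<in>UNIV. \<Sum>x'\<in>UNIV. if x' = x then (\<Sum>y'\<in>UNIV. \<rho> $ (x, y) $ (x', y') * Q $ y' $ y) else 0)"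
    by (intro sum.cong refl) auto
  also have "\<dots> = (\<Sum>x\<in>UNIV. \<Sum>y\<in>UNIV. \<Sum>y'\<in>UNIV. \<rho> $ (x, y) $ (x, y') * Q $ y' $ y)"
    by simp
  also have "\<dots> = (\<Sum>y\<in>UNIV. \<Sum>x\<in>UNIV. \<Sum>y'\<in>UNIV. \<rho> $ (x, y) $ (x, y') * Q $ y' $ y)"
    by (rule sum.swap)
  also have "\<dots> = (\<Sum>y\<in>UNIV. \<Sum>y'\<in>UNIV. \<Sum>x\<in>UNIV. \<rho> $ (x, y) $ (x, y') * Q $ y' $ y)"
    by (intro sum.cong refl sum.swap)
  finally show ?thesis by (simp add: sum_distrib_right)
qed

lemma ptrace_left_characterization:
  fixes \<rho> :: "('a::occupation \<times> 'b::occupation) oper"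
  shows "(parity_respecting \<sigma> \<and> (\<forall>Q. observable Q \<longrightarrow> trace (\<sigma> ** Q) = trace (\<rho> ** (\<I> \<and>\<^sub>f Q)))) \<longleftrightarrow>
    \<sigma> = (\<chi> y y'. if even (fermion_number y) = even (fermion_number y')
                 then \<Sum>x\<in>UNIV. \<rho> $ (x, y) $ (x, y') else 0)" (is "?L \<longleftrightarrow> \<sigma> = ?R")
proof
  assume "\<sigma> = ?R"
  moreover have "trace (?R ** Q) = trace (\<rho> ** (\<I> \<and>\<^sub>f Q))" if "observable Q" for Q
    using that unfolding trace_mult_Id_wedge trace_mult[of ?R] observable_def parity_respecting_iff
    by (intro sum.cong refl) auto
  ultimately show ?L by (auto simp: parity_respecting_iff)
next
  assume L: ?L
  have "\<sigma> $ y $ y' = (\<Sum>x\<in>UNIV. \<rho> $ (x, y) $ (x, y'))"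
    if e: "even (fermion_number y) = even (fermion_number y')" for y y'
  proof -
    define T where "T u v = (\<Sum>x\<in>UNIV. \<rho> $ (x, u) $ (x, v))" for u v
    define Q :: "complex \<Rightarrow> 'b oper" where
      "Q c = (\<chi> u v. c * ((if u = y' then 1 else 0) * (if v = y then 1 else 0))
             + cnj c * ((if u = y then 1 else 0) * (if v = y' then 1 else 0)))" for c
    have obs: "observable (Q c)" for c
      using e by (auto simp: observable_def dagger_def Q_def vec_eq_iff parity_respecting_iff)
    have ev: "(\<Sum>u\<in>UNIV. \<Sum>v\<in>UNIV. S u v * Q c $ v $ u) = c * S y y' + cnj c * S y' y"
      for S :: "'b \<Rightarrow> 'b \<Rightarrow> complex" and c
    proof -
      have "(\<Sum>u\<in>UNIV. \<Sum>v\<in>UNIV. S u v * Q c $ v $ u)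
        = (\<Sum>u\<in>UNIV. \<Sum>v\<in>UNIV. (if v = y' then if u = y then c * S u v else 0 else 0)
            + (if v = y then if u = y' then cnj c * S u v else 0 else 0))"
        by (intro sum.cong refl) (auto simp: Q_def algebra_simps)
      also have "\<dots> = c * S y y' + cnj c * S y' y"
        by (simp add: sum.distrib)
      finally show ?thesis .
    qed
    have "c * \<sigma> $ y $ y' + cnj c * \<sigma> $ y' $ y = c * T y y' + cnj c * T y' y" for c
    proof -
      have "trace (\<sigma> ** Q c) = trace (\<rho> ** (\<I> \<and>\<^sub>f Q c))" using L obs by blast
      then show ?thesis
        unfolding trace_mult_Id_wedge trace_mult[of \<sigma>] T_def[symmetric] ev .
    qed
    from this[of 1] this[of \<i>] have
      "\<sigma> $ y $ y' + \<sigma> $ y' $ y = T y y' + T y' y" "\<sigma> $ y $ y' - \<sigma> $ y' $ y = T y y' - T y' y"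
      by (simp_all flip: right_diff_distrib)
    then have "2 * \<sigma> $ y $ y' = 2 * T y y'" by algebra
    then show ?thesis by (simp add: T_def)
  qed
  with L show "\<sigma> = ?R" by (auto simp: vec_eq_iff parity_respecting_iff)
qed

lemma ptrace_left_eq:
  "ptrace_left \<rho> = (\<chi> y y'. if even (fermion_number y) = even (fermion_number y')
                 then \<Sum>x\<in>UNIV. \<rho> $ (x, y) $ (x, y') else 0)"
  unfolding ptrace_left_def ptrace_left_characterization by (rule the_equality) auto


subsection \<open>Creation operators\<close>

lemma oper_ket_nth: "(A *v ket x) $ i = A $ i $ x"
proof -
  have "(A *v ket x) $ i = (\<Sum>k\<in>UNIV. if k = x then A $ i $ k else 0)"
    unfolding matrix_vector_mult_def vec_lambda_beta
    by (intro sum.cong refl) (simp add: ket_def axis_def)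
  then show ?thesis by (simp add: sum.delta)
qed

lemma oper_eqI:
  assumes "\<And>x. A *v ket x = B *v ket x"
  shows "A = B"
  using assms by (simp add: vec_eq_iff oper_ket_nth)

lemma oper_scale: "A *v (a *s w) = a *s (A *v w)" for A :: "complex ^ 'a::finite ^ 'b::finite"
  by (simp add: vec_eq_iff matrix_vector_mult_def sum_distrib_left mult_ac)

lemma create_ket:
  "create j *v ket x = (if j \<in> x then 0 else (-1) ^ card {i\<in>x. i < j} *s ket (insert j x))"
  by (auto simp: vec_eq_iff oper_ket_nth) (auto simp: create_def ket_def axis_def)

lemma creation_string_foldr:
  "creation_string c x *v v = foldr (\<lambda>j. (*v) (c j)) (sorted_list_of_set x) v"
proof -
  have "foldr (\<lambda>j A. c j ** A) xs \<I> *v v = foldr (\<lambda>j. (*v) (c j)) xs v" for xs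
    by (induction xs) (simp_all add: matrix_vector_mul_assoc[symmetric])
  then show ?thesis by (simp add: creation_string_def)
qed

lemma creation_string_vacuum: "creation_string create x *v ket {} = ket x"
proof -
  have "foldr (\<lambda>j. (*v) (create j)) xs (ket {}) = ket (set xs)"
    if "sorted xs" "distinct xs" for xs :: "'a list"
    using that
  proof (induction xs)
    case (Cons j xs)
    have "{i \<in> set xs. i < j} = {}" using Cons.prems by auto
    then have "(-1 :: complex) ^ card {i \<in> set xs. i < j} = 1" by (metis card.empty power_0)
    with Cons show ?case by (simp add: create_ket)
  qed simp
  from this[of "sorted_list_of_set x"] show ?thesis by (simp add: creation_string_foldr)
qed

lemma dagger_create_ket:
  "dagger (create j) *v ket x
    = (if j \<in> x then (-1) ^ card {i\<in>x. i < j} *s ket (x - {j}) else 0)"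
proof -
  have *: "{i. (i = j \<or> i \<in> y) \<and> i < j} = {i\<in>y. i < j}" for y :: "'a set" by auto
  show ?thesis
    by (auto simp: vec_eq_iff oper_ket_nth) (auto simp: create_def dagger_def ket_def axis_def *)
qed

lemma card_insert_less:
  "card {k. (k = i \<or> k \<in> x) \<and> k < j} = (if i < j \<and> i \<notin> x then 1 else 0) + card {k\<in>x. k < j}"
  for x :: "'n::{finite,linorder} set"
proof -
  have "{k. (k = i \<or> k \<in> x) \<and> k < j} = (if i < j then insert i {k\<in>x. k < j} else {k\<in>x. k < j})"
    by auto
  then show ?thesis by (auto simp: insert_absorb)
qed

lemma card_remove_less:
  fixes x :: "'n::{finite,linorder} set"
  assumes "i \<in> x"
  shows "card {k\<in>x. k < j} = (if i < j then 1 else 0) + card {k. k \<in> x \<and> k \<noteq> i \<and> k < j}"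
proof -
  have "{k. (k = i \<or> k \<in> x - {i}) \<and> k < j} = {k\<in>x. k < j}" using assms by auto
  moreover have "{k \<in> x - {i}. k < j} = {k. k \<in> x \<and> k \<noteq> i \<and> k < j}" by auto
  ultimately show ?thesis using card_insert_less[of i "x - {i}" j] by simp
qed

text \<open>The canonical anticommutation relations.\<close>

lemma create_anticommute: "create i ** create j + create j ** create i = 0"
  for i j :: "'n::{finite,linorder}"
proof (rule oper_eqI)
  fix x :: "'n set"
  have "create i *v (create j *v ket x) + create j *v (create i *v ket x) = 0"
    by (cases i j rule: linorder_cases)
      (auto simp: create_ket oper_scale card_insert_less insert_commute vec_eq_iff)
  then show "(create i ** create j + create j ** create i) *v ket x = 0 *v ket x"
    by (simp only: matrix_vector_mult_add_rdistrib matrix_vector_mul_assoc[symmetric])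
      (simp add: vec_eq_iff matrix_vector_mult_def)
qed

lemma annihilate_create:
  "dagger (create i) ** create j + create j ** dagger (create i) = (if i = j then \<I> else 0)"
  for i j :: "'n::{finite,linorder}"
proof (rule oper_eqI)
  fix x :: "'n set"
  have sq: "(-1) ^ n * ((-1) ^ n * z) = z" for n and z :: complex
    by (simp add: mult.assoc[symmetric] power_mult_distrib[symmetric])
  have c: "insert j (x - {i}) = insert j x - {i}" if "i \<noteq> j" using that by auto
  have m: "A *v (- w) = - (A *v w)" for A :: "'n set oper" and w
    by (simp add: vec_eq_iff matrix_vector_mult_def sum_negf)
  have z: "A *v 0 = 0" for A :: "'n set oper"
    by (simp add: vec_eq_iff matrix_vector_mult_def)
  have r: "(if i = j then \<I> else 0) *v ket x = (if i = j then ket x else 0)"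
    by (simp add: vec_eq_iff oper_ket_nth) (simp add: mat_def ket_def axis_def)
  have "dagger (create i) *v (create j *v ket x) + create j *v (dagger (create i) *v ket x)
      = (if i = j then \<I> else 0) *v ket x"
    unfolding r
    by (cases i j rule: linorder_cases; cases "i \<in> x")
      (auto simp: create_ket dagger_create_ket oper_scale card_insert_less
        card_remove_less[of i x j] c insert_absorb vec_eq_iff sq m z)
  then show "(dagger (create i) ** create j + create j ** dagger (create i)) *v ket x
      = (if i = j then \<I> else 0) *v ket x"
    by (simp only: matrix_vector_mult_add_rdistrib matrix_vector_mul_assoc[symmetric])
qed

lemma creation_string_on_left: "creation_string (on_left c) x = creation_string c x \<and>\<^sub>f \<I>"
proof -
  have "foldr (\<lambda>j A. on_left c j ** A) xs \<I> = foldr (\<lambda>j A. c j ** A) xs \<I> \<and>\<^sub>f \<I>" for xs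
    by (induction xs) (simp_all add: on_left_def wedge_mult wedge_Id)
  then show ?thesis by (simp add: creation_string_def)
qed

lemma wedge_ket_scale: "(r *s u) \<and>\<^sub>k w = r *s (u \<and>\<^sub>k w)" "u \<and>\<^sub>k (r *s w) = r *s (u \<and>\<^sub>k w)"
  by (simp_all add: vec_eq_iff wedge_ket_def)

lemma Sz_ket: "\<S> *v ket y = (-1) ^ fermion_number y *s ket y"
  by (simp add: vec_eq_iff Sz_mult_ket) (simp add: ket_def axis_def)

lemma creation_string_on_right_ket:
  "creation_string (on_right c) x *v (ket y \<and>\<^sub>k v)
    = (-1) ^ (card x * fermion_number y) *s (ket y \<and>\<^sub>k (creation_string c x *v v))"
proof -
  have "foldr (\<lambda>j. (*v) (on_right c j)) xs (ket y \<and>\<^sub>k v)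
      = (-1) ^ (length xs * fermion_number y) *s (ket y \<and>\<^sub>k foldr (\<lambda>j. (*v) (c j)) xs v)" for xs
  proof (induction xs)
    case (Cons j xs)
    show ?case
      by (simp add: Cons.IH on_right_def[of c j] oper_scale wedge_mult_ket Sz_ket wedge_ket_scale
          vector_smult_assoc flip: power_add) (simp add: add.commute)
  qed simp
  then show ?thesis by (simp add: creation_string_foldr)
qed

lemma creation_string_left_ket:
  "creation_string (on_left c) x *v ket (y, z) = (creation_string c x *v ket y) \<and>\<^sub>k ket z"
  by (simp add: creation_string_on_left wedge_mult_ket flip: wedge_ket_ket)

lemma creation_string_right_ket:
  "creation_string (on_right c) x *v ket (y, z)
    = (-1) ^ (card x * fermion_number y) *s (ket y \<and>\<^sub>k (creation_string c x *v ket z))"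
  by (simp add: creation_string_on_right_ket flip: wedge_ket_ket)

text \<open>The wedge basis: creation operators of the left part precede those of the right part.\<close>

lemma wedge_basis:
  "(creation_string (on_left create) x ** creation_string (on_right create) y) *v ket ({}, {})
    = ket (x, y)"
  by (simp add: matrix_vector_mul_assoc[symmetric] creation_string_right_ket
      creation_string_left_ket creation_string_vacuum fermion_number_set_def wedge_ket_ket)

lemma reordered_ket_eq:
  "reordered_ket ((a, x), (b, a')) = (-1) ^ (card a' * (card x + card b)) *s ket ((a, a'), (x, b))"
  by (simp add: reordered_ket_def matrix_vector_mul_assoc[symmetric] creation_string_left_ket
      creation_string_right_ket creation_string_vacuum oper_scale wedge_ket_ket wedge_ket_scale
      fermion_number_set_def fermion_number_prod_def vector_smult_assoc flip: power_add)
    (simp add: algebra_simps)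

end

theory Submission
  imports Defs "HOL-Number_Theory.Cong"
begin

text \<open>
  Enumerate the basis by \<open>k < d\<close>, so that \<open>weyl \<kappa> p q\<close> is the shift by \<open>q\<close> times the character \<open>p\<close>.
  In a matrix element of the output between the basis kets \<open>i\<close> and \<open>j\<close> of \<open>B\<close>, let \<open>k\<close> and \<open>l\<close> be the
  row and column index of \<open>|\<psi>\<rangle>\<langle>\<psi>|\<close> on the first input system.  The sum over \<open>p\<close> forces
  \<open>i + l \<equiv> j + k\<close> modulo \<open>d\<close>, and the resource enters only through its elements at the shifted
  indices.  The noise term forces \<open>k = l\<close>, which traces out the first input system; the Bell term
  forces \<open>k = i\<close> and \<open>l = j\<close>, which returns \<open>|\<psi>\<rangle>\<langle>\<psi>|\<close>.  As \<open>d\<close> is even, shifting by \<open>q\<close> changes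
  all parities simultaneously, so the reordering signs cancel and relative parities survive.
  In the \<open>\<S> \<and> \<S>\<close> term there remains \<open>(-1)\<^sup>k\<^sup>+\<^sup>i\<close>, and the definite parity of \<open>\<psi>\<close> converts
  \<open>(-1)\<^sup>k\<close> into the global sign times the parity of the second input system.
\<close>

section \<open>Matrix elements\<close>

lemma sum_UNIV_prod:
  "(\<Sum>p\<in>UNIV. f p) = (\<Sum>x\<in>UNIV. \<Sum>y\<in>UNIV. f (x, y))"
  for f :: "'a::finite \<times> 'b::finite \<Rightarrow> 'c::comm_monoid_add"
  by (simp add: sum.cartesian_product flip: UNIV_Times_UNIV)

lemma wedge_ident_mult_nth:
  "((A \<and>\<^sub>f \<I>) ** X) $ (a, b) $ q = (\<Sum>c\<in>UNIV. A $ a $ c * X $ (c, b) $ q)"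
proof -
  have "A $ a $ c * \<I> $ b $ y * X $ (c, y) $ q
      = (if b = y then A $ a $ c * X $ (c, b) $ q else 0)" for c y
    by (simp add: mat_def)
  then show ?thesis
    by (simp add: matrix_matrix_mult_def wedge_def sum_UNIV_prod sum.delta')
qed

lemma mult_wedge_ident_nth:
  "(X ** (A \<and>\<^sub>f \<I>)) $ p $ (a, b) = (\<Sum>c\<in>UNIV. X $ p $ (c, b) * A $ c $ a)"
proof -
  have "X $ p $ (c, y) * (A $ c $ a * \<I> $ y $ b)
      = (if y = b then X $ p $ (c, b) * A $ c $ a else 0)" for c y
    by (simp add: mat_def)
  then show ?thesis
    by (simp add: matrix_matrix_mult_def wedge_def sum_UNIV_prod sum.delta)
qed

lemma ketbra_nth: "ketbra u v $ x $ y = u $ x * cnj (v $ y)"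
  by (simp add: ketbra_def)

lemma psi_plus_nth:
  "(psi_plus :: ('n::finite set \<times> 'n set) ket) $ (x, y)
    = (if x = y then complex_of_real (1 / sqrt (2 ^ CARD('n))) else 0)"
proof -
  have "(\<Sum>z\<in>A. ket z \<and>\<^sub>k ket z) $ (x, y) = (if x = y \<and> x \<in> A then 1 else 0)"
    for A :: "'n set set"
  proof -
    have "(\<Sum>z\<in>A. ket z \<and>\<^sub>k ket z) $ (x, y)
        = (\<Sum>z\<in>A. if x = z then if x = y then 1 else 0 else 0)"
      unfolding sum_component
      by (intro sum.cong refl) (auto simp: wedge_ket_def ket_def axis_def)
    then show ?thesis by (simp add: sum.delta')
  qed
  then show ?thesis by (auto simp: psi_plus_def scaleR_conv_of_real[where 'a=complex])
qed

lemma psi_plus_ketbra_nth: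
  "ketbra psi_plus psi_plus $ (x, y) $ (x', y')
    = (if x = y \<and> x' = y' then 1 / 2 ^ CARD('n) else 0)"
  for x y x' y' :: "'n::finite set"
  by (simp add: ketbra_def psi_plus_nth flip: of_real_mult)

text \<open>The Bell vector \<open>(U \<and>\<^sub>f \<I>) *v psi_plus\<close> is the vectorised
  Weyl unitary: its amplitudes are the entries of \<open>U\<close> divided by the square root of the
  dimension.\<close>

lemma bell_proj_nth:
  "bell_proj \<kappa> p q $ (a, x) $ (a', x')
    = weyl \<kappa> p q $ a $ x * cnj (weyl \<kappa> p q $ a' $ x') / 2 ^ CARD('n)"
  for \<kappa> :: "nat \<Rightarrow> 'n::finite set"
proof -
  have "weyl \<kappa> p q $ a $ b * ketbra psi_plus psi_plus $ (b, x) $ (c, x')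
      = (if b = x then if c = x' then weyl \<kappa> p q $ a $ x / 2 ^ CARD('n) else 0 else 0)" for b c
    by (simp add: psi_plus_ketbra_nth)
  moreover have "(if c = x' then u else 0) * v = (if c = x' then u * v else 0)"
    for c u and v :: complex
    by simp
  ultimately show ?thesis
    by (simp add: bell_proj_def mult_wedge_ident_nth wedge_ident_mult_nth dagger_def sum.delta)
qed

section \<open>Weyl unitaries in an enumerated basis\<close>

text \<open>The character in the Weyl entries, defined for all naturals and not only below
  \<open>d\<close>, because sums such as \<open>i + l\<close> later occur as arguments.\<close>

definition phase :: "nat \<Rightarrow> nat \<Rightarrow> nat \<Rightarrow> complex" where
  "phase d p k = exp (2 * of_real pi * \<i> * of_nat p * of_nat k / of_nat d)"

lemma phase_power: "phase d p k = phase d 1 k ^ p"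
  by (simp add: phase_def field_simps flip: exp_of_nat_mult)

lemma phase_add: "phase d p (k + l) = phase d p k * phase d p l"
  by (simp add: phase_def field_simps add_divide_distrib flip: exp_add)

lemma phase_cnj: "phase d p k * cnj (phase d p k) = 1"
  by (simp add: phase_def exp_cnj flip: exp_add)

text \<open>The summand is the p-th power of a d-th root of unity, so this is a geometric sum; the
  ratio is 1 exactly when \<open>k\<close> and \<open>l\<close> are congruent.\<close>

lemma phase_orthogonality:
  assumes "d > 0"
  shows "(\<Sum>p<d. phase d p k * cnj (phase d p l)) = (if k mod d = l mod d then of_nat d else 0)"
proof -
  define z where "z = phase d 1 k * cnj (phase d 1 l)"
  have zp: "phase d p k * cnj (phase d p l) = z ^ p" for p
    unfolding z_def by (subst (1 2) phase_power) (simp add: power_mult_distrib)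
  have "z = 1 \<longleftrightarrow> phase d 1 k = phase d 1 l"
  proof
    assume "z = 1"
    then have "phase d 1 k * (phase d 1 l * cnj (phase d 1 l)) = phase d 1 l"
      by (simp add: z_def mult_ac)
    then show "phase d 1 k = phase d 1 l" by (simp only: phase_cnj mult_1_right)
  qed (use phase_cnj in \<open>simp add: z_def\<close>)
  also have "\<dots> \<longleftrightarrow> k mod d = l mod d"
    using complex_root_unity_eq[of d k l] assms by (simp add: phase_def)
  finally have z1: "z = 1 \<longleftrightarrow> k mod d = l mod d" .
  \<comment> \<open>The case \<open>p = d\<close> of \<open>zp\<close>, which yields that the ratio
    is a d-th root of unity.\<close>
  have "phase d d m = 1" for m
    using complex_root_unity_eq[of d "d * m" 0] assms by (simp add: phase_def mult.assoc)
  then have "z ^ d = 1" by (simp flip: zp)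
  then show ?thesis by (auto simp: zp z1[symmetric] geometric_sum)
qed

text \<open>The column of the only nonzero entry in row \<open>\<kappa> k\<close> of
  \<open>weyl \<kappa> p q\<close>; it does not depend on \<open>p\<close>.\<close>

definition shift :: "(nat \<Rightarrow> 'n::finite set) \<Rightarrow> nat \<Rightarrow> nat \<Rightarrow> 'n set" where
  "shift \<kappa> q k = \<kappa> ((k + q) mod 2 ^ CARD('n))"

lemma enumeration_eq_iff:
  assumes "basis_enumeration \<kappa>" "k < 2 ^ CARD('n)" "l < 2 ^ CARD('n)"
  shows "\<kappa> k = (\<kappa> l :: 'n::finite set) \<longleftrightarrow> k = l"
  using assms by (auto simp: basis_enumeration_def bij_betw_def inj_on_def)

lemma enumeration_surj:
  assumes "basis_enumeration \<kappa>"
  obtains k where "k < 2 ^ CARD('n)" "x = (\<kappa> k :: 'n::finite set)"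
  using assms unfolding basis_enumeration_def bij_betw_def by (metis imageE lessThan_iff UNIV_I)

lemma sum_enumeration:
  assumes "basis_enumeration \<kappa>"
  shows "(\<Sum>x\<in>UNIV. f x) = (\<Sum>k<2 ^ CARD('n). f (\<kappa> k :: 'n::finite set))"
  using assms sum.reindex_bij_betw[of \<kappa> "{..<2 ^ CARD('n)}" UNIV f]
  by (simp add: basis_enumeration_def)

lemma shift_eq_iff:
  assumes "basis_enumeration \<kappa>" "k < 2 ^ CARD('n)" "l < 2 ^ CARD('n)"
  shows "shift \<kappa> q k = (shift \<kappa> q l :: 'n::finite set) \<longleftrightarrow> k = l"
proof -
  have "(k + q) mod 2 ^ CARD('n) = (l + q) mod 2 ^ CARD('n) \<longleftrightarrow> k = l"
    using assms(2,3) cong_add_rcancel_nat[of k q l "2 ^ CARD('n)"] by (simp add: cong_def)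
  then show ?thesis using assms(1) by (auto simp: shift_def enumeration_eq_iff)
qed

lemma even_card_enumeration:
  assumes "basis_enumeration \<kappa>" "k < 2 ^ CARD('n)"
  shows "even (card (\<kappa> k :: 'n::finite set)) \<longleftrightarrow> even k"
  using assms by (auto simp: basis_enumeration_def fermion_number_set_def split: if_splits)

text \<open>There is at least one mode, so the dimension is even and reduction modulo it keeps
  parity.\<close>

lemma even_card_shift:
  assumes "basis_enumeration \<kappa>"
  shows "even (card (shift \<kappa> q k :: 'n::finite set)) \<longleftrightarrow> even (k + q)"
proof -
  have "even ((k + q) mod 2 ^ CARD('n)) \<longleftrightarrow> even (k + q)" by (rule dvd_mod_iff) simp
  then show ?thesis using assms by (simp add: shift_def even_card_enumeration)
qed

lemma weyl_nth:
  assumes "basis_enumeration \<kappa>" "k < 2 ^ CARD('n)"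
  shows "weyl \<kappa> p q $ (\<kappa> k) $ (y :: 'n::finite set)
    = (if y = shift \<kappa> q k then phase (2 ^ CARD('n)) p k else 0)"
proof -
  have "weyl \<kappa> p q $ (\<kappa> k) $ y
      = (\<Sum>l<2 ^ CARD('n). if k = l then if y = shift \<kappa> q k then phase (2 ^ CARD('n)) p k else 0 else 0)"
    unfolding weyl_def sum_component
    using assms by (intro sum.cong refl)
      (auto simp: ketbra_def ket_def axis_def phase_def shift_def enumeration_eq_iff)
  then show ?thesis using assms by (simp add: sum.delta')
qed

lemma weyl_conj_nth:
  assumes "basis_enumeration \<kappa>" "k < 2 ^ CARD('n)" "l < 2 ^ CARD('n)"
  shows "((weyl \<kappa> p q \<and>\<^sub>f \<I>) ** X ** (dagger (weyl \<kappa> p q) \<and>\<^sub>f \<I>)) $ (\<kappa> k, a) $ (\<kappa> l :: 'n::finite set, b)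
    = phase (2 ^ CARD('n)) p k * cnj (phase (2 ^ CARD('n)) p l)
      * X $ (shift \<kappa> q k, a) $ (shift \<kappa> q l, b)"
proof -
  have d: "(if c = s then u else 0) * v = (if c = s then u * v else 0)"
    "v * cnj (if c = s then u else 0) = (if c = s then v * cnj u else 0)"
    for c s :: "'n set" and u v :: complex
    by auto
  show ?thesis
    by (simp add: mult_wedge_ident_nth wedge_ident_mult_nth dagger_def weyl_nth assms d sum.delta)
qed

section \<open>Reordering signs and local-parity blocks\<close>

text \<open>Each reordered ket is a signed basis ket. Its sign comes from moving the
  \<open>card c\<close> creation operators of \<open>C'\<close> past those of \<open>A\<close> and
  \<open>B\<close>; the signs of row and column multiply.\<close>

lemma reorder_nth:
  "reorder \<rho> $ ((a, x), (b, c)) $ ((a', x'), (b', c'))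
    = (-1) ^ (card c * (card x + card b) + card c' * (card x' + card b'))
      * \<rho> $ ((a, c), (x, b)) $ ((a', c'), (x', b'))"
proof -
  have m: "cnj ((r *s ket y) $ i) * z = (if i = y then cnj r * z else 0)"
    for r z and y i :: "'b::finite"
    by (simp add: ket_def axis_def)
  show ?thesis
    by (simp add: reorder_def reordered_ket_eq m oper_scale sum.delta power_add
      del: vector_smult_component) (simp add: oper_ket_nth)
qed

lemma sector_proj_nth: "sector_proj s $ x $ y = (if x = y \<and> x \<in> sector s then 1 else 0)"
proof -
  have "sector_proj s $ x $ y
      = (\<Sum>z\<in>sector s. if x = z then if x = y then 1 else 0 else 0)"
    unfolding sector_proj_def sum_component
    by (intro sum.cong refl) (auto simp: ketbra_def ket_def axis_def)
  then show ?thesis by (simp add: sum.delta')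
qed

text \<open>The diagonal projectors select the entries whose row and column lie in the same sector
  pair \<open>(s, t)\<close>, and the four pairs are disjoint.\<close>

lemma loc_p_nth:
  "loc_p X $ (x, y) $ (x', y')
    = (if even (fermion_number x) = even (fermion_number x') \<and>
          even (fermion_number y) = even (fermion_number y') then X $ (x, y) $ (x', y') else 0)"
proof -
  have "((sector_proj s \<and>\<^sub>f sector_proj t) ** X ** (sector_proj s \<and>\<^sub>f sector_proj t)) $ (x, y) $ (x', y')
    = (if x \<in> sector s \<and> y \<in> sector t \<and> x' \<in> sector s \<and> y' \<in> sector t
       then X $ (x, y) $ (x', y') else 0)" for s t
  proof -
    have p: "(sector_proj s \<and>\<^sub>f sector_proj t) $ u $ v
        = (if u = v then if fst u \<in> sector s \<and> snd u \<in> sector t then 1 else 0 else 0)"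
      for u v :: "'a \<times> 'b"
      by (auto simp: wedge_def sector_proj_nth prod_eq_iff)
    have l: "(if c then a else 0) * z = (if c then a * z else 0)"
      "z * (if c then a else 0) = (if c then z * a else 0)" for c and a z :: complex
      by auto
    show ?thesis
      unfolding matrix_matrix_mult_def vec_lambda_beta p l by (simp add: sum.delta)
  qed
  then show ?thesis by (simp add: loc_p_def)
qed

section \<open>Matrix elements of the output\<close>

text \<open>Weyl rows have one nonzero entry, so the trace over the measured pair runs over
  \<open>k\<close> and \<open>l\<close> alone. The row \<open>k\<close> of \<open>R\<close> meets
  the column of the projector, hence the conjugated phase at \<open>k\<close>.\<close>

lemma ptrace_bell_nth:
  fixes \<kappa> :: "nat \<Rightarrow> 'n::finite set"
  assumes "basis_enumeration \<kappa>"
  shows "ptrace_left (R ** (bell_proj \<kappa> p q \<and>\<^sub>f \<I> \<and>\<^sub>f \<I>)) $ y $ y'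
    = (if even (fermion_number y) = even (fermion_number y') then
        \<Sum>k<2 ^ CARD('n). \<Sum>l<2 ^ CARD('n).
          R $ ((\<kappa> k, shift \<kappa> q k), y) $ ((\<kappa> l, shift \<kappa> q l), y')
          * (phase (2 ^ CARD('n)) p l * cnj (phase (2 ^ CARD('n)) p k)) / 2 ^ CARD('n)
       else 0)"
proof -
  have "(\<Sum>z\<in>UNIV. (R ** (bell_proj \<kappa> p q \<and>\<^sub>f \<I>)) $ (z, y) $ (z, y'))
    = (\<Sum>a\<in>UNIV. \<Sum>x\<in>UNIV. \<Sum>a'\<in>UNIV. \<Sum>x'\<in>UNIV. R $ ((a, x), y) $ ((a', x'), y')
        * (weyl \<kappa> p q $ a' $ x' * cnj (weyl \<kappa> p q $ a $ x) / 2 ^ CARD('n)))"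
    by (simp only: mult_wedge_ident_nth sum_UNIV_prod bell_proj_nth)
  also have "\<dots> = (\<Sum>k<2 ^ CARD('n). \<Sum>x\<in>UNIV. \<Sum>l<2 ^ CARD('n). \<Sum>x'\<in>UNIV.
      if x' = shift \<kappa> q l then if x = shift \<kappa> q k then R $ ((\<kappa> k, x), y) $ ((\<kappa> l, x'), y')
        * (phase (2 ^ CARD('n)) p l * cnj (phase (2 ^ CARD('n)) p k)) / 2 ^ CARD('n) else 0 else 0)"
    \<comment> \<open>Only \<open>a\<close> and \<open>a'\<close> are enumerated; \<open>x\<close>
      and \<open>x'\<close> stay sets, to be fixed by the Weyl entries.\<close>
    unfolding sum_enumeration[OF assms, where f = "\<lambda>a. \<Sum>x\<in>UNIV. g a x" for g :: "_ \<Rightarrow> 'n set \<Rightarrow> _"]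
    using assms by (intro sum.cong refl) (simp add: weyl_nth)
  also have "\<dots> = (\<Sum>k<2 ^ CARD('n). \<Sum>x\<in>UNIV. if x = shift \<kappa> q k then \<Sum>l<2 ^ CARD('n).
      R $ ((\<kappa> k, x), y) $ ((\<kappa> l, shift \<kappa> q l), y')
        * (phase (2 ^ CARD('n)) p l * cnj (phase (2 ^ CARD('n)) p k)) / 2 ^ CARD('n) else 0)"
    by (intro sum.cong refl) (simp add: sum.delta)
  also have "\<dots> = (\<Sum>k<2 ^ CARD('n). \<Sum>l<2 ^ CARD('n).
      R $ ((\<kappa> k, shift \<kappa> q k), y) $ ((\<kappa> l, shift \<kappa> q l), y')
        * (phase (2 ^ CARD('n)) p l * cnj (phase (2 ^ CARD('n)) p k)) / 2 ^ CARD('n))"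
    by (simp add: sum.delta)
  finally show ?thesis by (simp add: ptrace_left_eq wedge_Id)
qed

text \<open>The phases of the measurement and of the correction combine into \<open>phase\<close> at
  \<open>i + l\<close> against \<open>j + k\<close>. Orthogonality over \<open>p\<close> gives the
  congruence and a factor \<open>d\<close> that cancels the normalisation of the Bell projector. The
  parity condition comes from the fermionic partial trace.\<close>

lemma teleport_output_nth:
  assumes \<kappa>: "basis_enumeration \<kappa>" and i: "i < 2 ^ CARD('n)" and j: "j < 2 ^ CARD('n)"
  shows "teleport_output \<kappa> \<psi> \<omega> $ (\<kappa> i, a) $ (\<kappa> j :: 'n::{finite,linorder} set, b)
    = (\<Sum>q<2 ^ CARD('n). \<Sum>k<2 ^ CARD('n). \<Sum>l<2 ^ CARD('n).
        if (i + l) mod 2 ^ CARD('n) = (j + k) mod 2 ^ CARD('n) \<and>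
           even (i + card a) = even (j + card b)
        then (-1) ^ (card a * (k + i) + card b * (l + j)) * (\<psi> $ (\<kappa> k, a) * cnj (\<psi> $ (\<kappa> l, b)))
          * \<omega> $ (shift \<kappa> q k, shift \<kappa> q i) $ (shift \<kappa> q l, shift \<kappa> q j) else 0)"
proof -
  let ?D = "2 ^ CARD('n) :: nat" and ?e = "phase (2 ^ CARD('n))"
  define P where "P \<longleftrightarrow> even (i + card a) = even (j + card b)"
  define G where "G q k l = (if P
        then (-1) ^ (card a * (k + i) + card b * (l + j)) * (\<psi> $ (\<kappa> k, a) * cnj (\<psi> $ (\<kappa> l, b)))
          * \<omega> $ (shift \<kappa> q k, shift \<kappa> q i) $ (shift \<kappa> q l, shift \<kappa> q j) else 0)" for q k l
  have parity: "even (fermion_number (shift \<kappa> q i, a)) = even (fermion_number (shift \<kappa> q j, b))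
      \<longleftrightarrow> P" for q
    using even_card_shift[OF \<kappa>, of q]
    by (simp add: fermion_number_prod_def fermion_number_set_def P_def) blast
  \<comment> \<open>The shift \<open>q\<close> enters each inner sum of cardinalities twice, so it
    drops out of the sign.\<close>
  have sign: "(-1 :: complex) ^ (card a * (card (shift \<kappa> q k) + card (shift \<kappa> q i))
        + card b * (card (shift \<kappa> q l) + card (shift \<kappa> q j)))
      = (-1) ^ (card a * (k + i) + card b * (l + j))" for q k l
    using even_card_shift[OF \<kappa>, of q] by (simp add: minus_one_power_iff) blast
  have "teleport_output \<kappa> \<psi> \<omega> $ (\<kappa> i, a) $ (\<kappa> j, b)
      = (\<Sum>p<?D. \<Sum>q<?D. ?e p i * cnj (?e p j) * (if P
          then \<Sum>k<?D. \<Sum>l<?D. G q k l * (?e p l * cnj (?e p k)) / ?D else 0))"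
    unfolding teleport_output_def sum_component weyl_conj_nth[OF assms] ptrace_bell_nth[OF \<kappa>] parity
    by (intro sum.cong refl arg_cong2[where f = "(*)"] if_cong)
      (simp add: reorder_nth sign G_def ketbra_def wedge_def)
  also have "\<dots> = (\<Sum>p<?D. \<Sum>q<?D. \<Sum>k<?D. \<Sum>l<?D.
        G q k l / ?D * (?e p (i + l) * cnj (?e p (j + k))))"
  proof (intro sum.cong refl)
    fix p q
    have "(if P
          then \<Sum>k<?D. \<Sum>l<?D. G q k l * (?e p l * cnj (?e p k)) / ?D else 0)
        = (\<Sum>k<?D. \<Sum>l<?D. G q k l * (?e p l * cnj (?e p k)) / ?D)"
      unfolding G_def by (cases P) simp_all
    then show "?e p i * cnj (?e p j) * (if P
          then \<Sum>k<?D. \<Sum>l<?D. G q k l * (?e p l * cnj (?e p k)) / ?D else 0)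
        = (\<Sum>k<?D. \<Sum>l<?D. G q k l / ?D * (?e p (i + l) * cnj (?e p (j + k))))"
      by (simp add: sum_distrib_left phase_add mult_ac)
  qed
  \<comment> \<open>Only the phases depend on \<open>p\<close>, so its sum moves innermost.\<close>
  also have "\<dots> = (\<Sum>q<?D. \<Sum>k<?D. \<Sum>l<?D.
        G q k l / ?D * (\<Sum>p<?D. ?e p (i + l) * cnj (?e p (j + k))))"
    unfolding sum_distrib_left
    by (rule trans[OF sum.swap], rule sum.cong[OF refl])+ (rule refl)
  also have "\<dots> = (\<Sum>q<?D. \<Sum>k<?D. \<Sum>l<?D.
        if (i + l) mod ?D = (j + k) mod ?D then G q k l else 0)"
    by (intro sum.cong refl) (simp add: phase_orthogonality)
  finally show ?thesis
    unfolding G_def P_def by (auto intro!: sum.cong)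
qed

lemma oper_prod_eqI:
  fixes A B :: "('n::finite set \<times> 'b::finite) oper"
  assumes "basis_enumeration \<kappa>"
    and "\<And>i j a b. i < 2 ^ CARD('n) \<Longrightarrow> j < 2 ^ CARD('n) \<Longrightarrow>
      A $ (\<kappa> i, a) $ (\<kappa> j, b) = B $ (\<kappa> i, a) $ (\<kappa> j, b)"
  shows "A = B"
proof -
  have "A $ (x, a) $ (y, b) = B $ (x, a) $ (y, b)" for x y a b
    using assms(2) by (metis enumeration_surj[OF assms(1)])
  then show ?thesis by (simp add: vec_eq_iff)
qed

section \<open>Linearity of the protocol in the resource\<close>

lemma if_mult_linear:
  fixes f x y :: complex
  shows "(if P then f * (x + y) else 0) = (if P then f * x else 0) + (if P then f * y else 0)"
    and "(if P then f * (r *\<^sub>R x) else 0) = r *\<^sub>R (if P then f * x else 0)"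
  by (simp_all add: distrib_left)

lemma teleport_output_add:
  assumes "basis_enumeration \<kappa>"
  shows "teleport_output \<kappa> \<psi> (\<omega> + \<omega>') = teleport_output \<kappa> \<psi> \<omega> + teleport_output \<kappa> \<psi> \<omega>'"
  by (rule oper_prod_eqI[OF assms])
    (simp only: teleport_output_nth[OF assms] vector_add_component if_mult_linear sum.distrib)

lemma teleport_output_scaleR:
  assumes "basis_enumeration \<kappa>"
  shows "teleport_output \<kappa> \<psi> (r *\<^sub>R \<omega>) = r *\<^sub>R teleport_output \<kappa> \<psi> \<omega>"
  by (rule oper_prod_eqI[OF assms])
    (simp only: teleport_output_nth[OF assms] vector_scaleR_component if_mult_linear scaleR_right.sum)

section \<open>The components of the resource\<close>

lemma ident_wedge_nth: "(\<I> \<and>\<^sub>f A) $ (x, y) $ (x', y') = (if x = x' then A $ y $ y' else 0)"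
  by (simp add: wedge_def mat_def)

lemma ptrace_left_ketbra_nth:
  fixes \<psi> :: "('n::finite set \<times> 'n set) ket"
  assumes "basis_enumeration \<kappa>"
  shows "ptrace_left (ketbra \<psi> \<psi>) $ a $ b = (if even (card a) = even (card b) then
     \<Sum>k<2 ^ CARD('n). \<psi> $ (\<kappa> k, a) * cnj (\<psi> $ (\<kappa> k, b)) else 0)"
  by (simp add: ptrace_left_eq fermion_number_set_def ketbra_def sum_enumeration[OF assms])

text \<open>Injectivity of the shift leaves \<open>k = l\<close> and \<open>i = j\<close>. The sign
  exponent is then \<open>(card a + card b) * (k + i)\<close>, even when \<open>a\<close> and
  \<open>b\<close> have equal parity. All \<open>q\<close> contribute equally, which gives the
  dimension factor.\<close>

lemma teleport_output_ident:
  fixes \<psi> :: "('n::{finite,linorder} set \<times> 'n set) ket"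
  assumes "basis_enumeration \<kappa>"
  shows "teleport_output \<kappa> \<psi> (\<I> \<and>\<^sub>f \<I>) = (2 ^ CARD('n) :: real) *\<^sub>R (\<I> \<and>\<^sub>f ptrace_left (ketbra \<psi> \<psi>))"
proof (rule oper_prod_eqI[OF assms])
  fix i j :: nat and a b :: "'n set"
  assume i: "i < 2 ^ CARD('n)" and j: "j < 2 ^ CARD('n)"
  let ?D = "2 ^ CARD('n) :: nat"
  let ?f = "\<lambda>k. if even (card a) = even (card b) then \<psi> $ (\<kappa> k, a) * cnj (\<psi> $ (\<kappa> k, b)) else 0"
  have "teleport_output \<kappa> \<psi> (\<I> \<and>\<^sub>f \<I>) $ (\<kappa> i, a) $ (\<kappa> j, b)
    = (\<Sum>q<?D. \<Sum>k<?D. \<Sum>l<?D. if k = l then if i = j then ?f k else 0 else 0)"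
    unfolding teleport_output_nth[OF assms i j]
  proof (intro sum.cong refl)
    fix q k l assume "k \<in> {..<?D}" "l \<in> {..<?D}"
    then have "(\<I> \<and>\<^sub>f \<I>) $ (shift \<kappa> q k, shift \<kappa> q i) $ (shift \<kappa> q l, shift \<kappa> q j)
        = (if k = l \<and> i = j then 1 else (0 :: complex))"
      using i j by (auto simp: wedge_def mat_def shift_eq_iff[OF assms])
    then show "(if (i + l) mod ?D = (j + k) mod ?D \<and> even (i + card a) = even (j + card b)
        then (-1) ^ (card a * (k + i) + card b * (l + j)) * (\<psi> $ (\<kappa> k, a) * cnj (\<psi> $ (\<kappa> l, b)))
          * (\<I> \<and>\<^sub>f \<I>) $ (shift \<kappa> q k, shift \<kappa> q i) $ (shift \<kappa> q l, shift \<kappa> q j) else 0)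
      = (if k = l then if i = j then ?f k else 0 else 0)"
      by (cases "k = l \<and> i = j"; cases "even (card a) = even (card b)")
        (auto simp: add.commute minus_one_power_iff)
  qed
  also have "\<dots> = ?D * (if i = j then \<Sum>k<?D. ?f k else 0)"
    by (simp add: sum.delta')
  finally show "teleport_output \<kappa> \<psi> (\<I> \<and>\<^sub>f \<I>) $ (\<kappa> i, a) $ (\<kappa> j, b)
     = ((2 ^ CARD('n) :: real) *\<^sub>R (\<I> \<and>\<^sub>f ptrace_left (ketbra \<psi> \<psi>))) $ (\<kappa> i, a) $ (\<kappa> j, b)"
    using i j by (simp add: ident_wedge_nth ptrace_left_ketbra_nth[OF assms] enumeration_eq_iff[OF assms]
      scaleR_conv_of_real[where 'a=complex])
qed

section \<open>Definite parity and the parity-correlated noise\<close>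

lemma definite_parity:
  assumes "parity_respecting (ketbra \<psi> \<psi>)"
    and "even (fermion_number x) \<noteq> even (fermion_number y)"
  shows "\<psi> $ x * cnj (\<psi> $ y) = 0"
  using assms by (auto simp: parity_respecting_iff ketbra_def)

lemma even_ket_nth:
  assumes "even_ket \<psi>" "odd (fermion_number x)"
  shows "\<psi> $ x = 0"
proof -
  have "(\<S> *v \<psi>) $ x = \<psi> $ x" using assms(1) by (simp add: even_ket_def)
  with assms(2) show ?thesis by (simp add: Sz_mult_ket)
qed

lemma odd_ket_nth:
  assumes "odd_ket \<psi>" "even (fermion_number x)"
  shows "\<psi> $ x = 0"
proof -
  have "(\<S> *v \<psi>) $ x = - \<psi> $ x" using assms(1) by (simp add: odd_ket_def)
  with assms(2) show ?thesis by (simp add: Sz_mult_ket)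
qed

lemma teleport_output_Sz:
  fixes \<psi> :: "('n::{finite,linorder} set \<times> 'n set) ket"
  assumes \<kappa>: "basis_enumeration \<kappa>"
    and parity: "sg = 1 \<and> even_ket \<psi> \<or> sg = -1 \<and> odd_ket \<psi>"
  shows "teleport_output \<kappa> \<psi> (\<S> \<and>\<^sub>f \<S>)
    = (sg * 2 ^ CARD('n) :: real) *\<^sub>R ((\<I> \<and>\<^sub>f ptrace_left (ketbra \<psi> \<psi>)) ** (\<S> \<and>\<^sub>f \<S>))"
proof (rule oper_prod_eqI[OF \<kappa>])
  fix i j :: nat and a b :: "'n set"
  assume i: "i < 2 ^ CARD('n)" and j: "j < 2 ^ CARD('n)"
  let ?D = "2 ^ CARD('n) :: nat"
  let ?f = "\<lambda>k. if even (card a) = even (card b) then \<psi> $ (\<kappa> k, a) * cnj (\<psi> $ (\<kappa> k, b)) else 0"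
  \<comment> \<open>\<open>sg\<close> times the total parity of the column
    \<open>(\<kappa> j, b)\<close>, as \<open>i = j\<close> in every surviving term.\<close>
  let ?s = "sg * (-1) ^ (i + card b)"
  \<comment> \<open>On the support of \<open>\<psi>\<close> the parity of \<open>k + card b\<close>
    is fixed by \<open>sg\<close>, so the sign can be freed of \<open>k\<close> and leave the
    sum.\<close>
  have sign: "(-1) ^ (k + i) * \<psi> $ (\<kappa> k, b) = of_real ?s * \<psi> $ (\<kappa> k, b)" if "k < ?D" for k
    using parity even_ket_nth[of \<psi> "(\<kappa> k, b)"] odd_ket_nth[of \<psi> "(\<kappa> k, b)"] even_card_enumeration[OF \<kappa> that]
    by (auto simp: fermion_number_prod_def fermion_number_set_def minus_one_power_iff)
  have "teleport_output \<kappa> \<psi> (\<S> \<and>\<^sub>f \<S>) $ (\<kappa> i, a) $ (\<kappa> j, b)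
    = (\<Sum>q<?D. \<Sum>k<?D. \<Sum>l<?D. if k = l then if i = j then of_real ?s * ?f k else 0 else 0)"
    unfolding teleport_output_nth[OF \<kappa> i j]
  proof (intro sum.cong refl)
    fix q k l assume k: "k \<in> {..<?D}" and l: "l \<in> {..<?D}"
    have "(\<S> \<and>\<^sub>f \<S>) $ (shift \<kappa> q k, shift \<kappa> q i) $ (shift \<kappa> q l, shift \<kappa> q j)
        = (if k = l \<and> i = j then (-1) ^ (k + i) else (0 :: complex))"
      using i j k l by (auto simp: wedge_def Sz_nth shift_eq_iff[OF \<kappa>] fermion_number_set_def
          minus_one_power_iff even_card_shift[OF \<kappa>])
    \<comment> \<open>The sign is absorbed at the column index \<open>b\<close>, since
      \<open>\<S> \<and>\<^sub>f \<S>\<close> multiplies from the right in the claim.\<close>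
    moreover have "(-1) ^ (k + i) * cnj (\<psi> $ (\<kappa> k, b)) = of_real ?s * cnj (\<psi> $ (\<kappa> k, b))"
      using arg_cong[OF sign[of k], of cnj] k by simp
    then have "\<psi> $ (\<kappa> k, a) * cnj (\<psi> $ (\<kappa> k, b)) * (-1) ^ (k + i)
        = of_real ?s * (\<psi> $ (\<kappa> k, a) * cnj (\<psi> $ (\<kappa> k, b)))"
      by (metis mult.assoc mult.commute)
    ultimately show "(if (i + l) mod ?D = (j + k) mod ?D \<and> even (i + card a) = even (j + card b)
        then (-1) ^ (card a * (k + i) + card b * (l + j)) * (\<psi> $ (\<kappa> k, a) * cnj (\<psi> $ (\<kappa> l, b)))
          * (\<S> \<and>\<^sub>f \<S>) $ (shift \<kappa> q k, shift \<kappa> q i) $ (shift \<kappa> q l, shift \<kappa> q j) else 0)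
      = (if k = l then if i = j then of_real ?s * ?f k else 0 else 0)"
      by (cases "k = l \<and> i = j"; cases "even (card a) = even (card b)")
        (auto simp: add.commute power_add power_mult_distrib mult.assoc minus_one_power_iff)
  qed
  also have "\<dots> = ?D * (if i = j then of_real ?s * (\<Sum>k<?D. ?f k) else 0)"
    by (simp add: sum.delta' sum_distrib_left)
  finally have l: "teleport_output \<kappa> \<psi> (\<S> \<and>\<^sub>f \<S>) $ (\<kappa> i, a) $ (\<kappa> j, b)
    = ?D * (if i = j then of_real ?s * (\<Sum>k<?D. ?f k) else 0)" .
  have "(\<Sum>k<?D. ?f k) = ptrace_left (ketbra \<psi> \<psi>) $ a $ b"
    by (simp add: ptrace_left_ketbra_nth[OF \<kappa>])
  then have "teleport_output \<kappa> \<psi> (\<S> \<and>\<^sub>f \<S>) $ (\<kappa> i, a) $ (\<kappa> j, b)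
    = ?D * (if i = j then of_real ?s * ptrace_left (ketbra \<psi> \<psi>) $ a $ b else 0)"
    using l by simp
  then show "teleport_output \<kappa> \<psi> (\<S> \<and>\<^sub>f \<S>) $ (\<kappa> i, a) $ (\<kappa> j, b)
     = ((sg * 2 ^ CARD('n) :: real) *\<^sub>R ((\<I> \<and>\<^sub>f ptrace_left (ketbra \<psi> \<psi>)) ** (\<S> \<and>\<^sub>f \<S>))) $ (\<kappa> i, a) $ (\<kappa> j, b)"
    using i j even_card_enumeration[OF \<kappa> j]
    by (simp add: wedge_Sz Sz_mult_right ident_wedge_nth enumeration_eq_iff[OF \<kappa>]
      fermion_number_prod_def fermion_number_set_def minus_one_power_iff
      scaleR_conv_of_real[where 'a=complex])
qed

section \<open>The Bell component of the resource\<close>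

text \<open>The weights \<open>c\<close> within and \<open>c'\<close> across local parity sectors
  let one computation serve both parts of the Bell projector. With \<open>k = i\<close> and
  \<open>l = j\<close> the sign exponent is even, and the sum over \<open>q\<close> cancels the
  normalisation.\<close>

lemma teleport_output_correlated:
  fixes \<psi> :: "('n::{finite,linorder} set \<times> 'n set) ket"
  assumes \<kappa>: "basis_enumeration \<kappa>"
    and \<psi>: "parity_respecting (ketbra \<psi> \<psi>)"
    and \<omega>: "\<And>x y x' y'. \<omega> $ (x, y) $ (x', y') = (if x = y \<and> x' = y' then
        (if even (card x) = even (card x') then c else c') / 2 ^ CARD('n) else 0)"
  shows "teleport_output \<kappa> \<psi> \<omega> $ (x, a) $ (y, b)
    = (if even (card x) = even (card y) then c else c') * (\<psi> $ (x, a) * cnj (\<psi> $ (y, b)))"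
proof -
  let ?D = "2 ^ CARD('n) :: nat"
  obtain i j where i: "i < ?D" "x = \<kappa> i" and j: "j < ?D" "y = \<kappa> j"
    by (metis enumeration_surj[OF \<kappa>])
  let ?r = "(if even i = even j then c else c') * (\<psi> $ (\<kappa> i, a) * cnj (\<psi> $ (\<kappa> j, b)))"
  have "teleport_output \<kappa> \<psi> \<omega> $ (\<kappa> i, a) $ (\<kappa> j, b)
    = (\<Sum>q<?D. \<Sum>k<?D. \<Sum>l<?D. if l = j then if k = i then ?r / ?D else 0 else 0)"
    unfolding teleport_output_nth[OF \<kappa> i(1) j(1)]
  proof (intro sum.cong refl)
    fix q k l assume k: "k \<in> {..<?D}" and l: "l \<in> {..<?D}"
    \<comment> \<open>Where the fermionic partial trace deletes an entry, parity superselection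
      makes the target entry vanish too.\<close>
    have "\<psi> $ (\<kappa> i, a) = 0 \<or> \<psi> $ (\<kappa> j, b) = 0" if "even (i + card a) \<noteq> even (j + card b)"
      using definite_parity[OF \<psi>, of "(\<kappa> i, a)" "(\<kappa> j, b)"] that
        even_card_enumeration[OF \<kappa> i(1)] even_card_enumeration[OF \<kappa> j(1)]
      by (auto simp: fermion_number_prod_def fermion_number_set_def)
    \<comment> \<open>A common shift preserves the relative parity of \<open>i\<close> and
      \<open>j\<close>, so the weight is independent of \<open>q\<close>.\<close>
    moreover have "\<omega> $ (shift \<kappa> q k, shift \<kappa> q i) $ (shift \<kappa> q l, shift \<kappa> q j)
        = (if k = i \<and> l = j then (if even i = even j then c else c') / ?D else 0)"
      using i j k l by (auto simp: \<omega> shift_eq_iff[OF \<kappa>] even_card_shift[OF \<kappa>])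
    ultimately show "(if (i + l) mod ?D = (j + k) mod ?D \<and> even (i + card a) = even (j + card b)
        then (-1) ^ (card a * (k + i) + card b * (l + j)) * (\<psi> $ (\<kappa> k, a) * cnj (\<psi> $ (\<kappa> l, b)))
          * \<omega> $ (shift \<kappa> q k, shift \<kappa> q i) $ (shift \<kappa> q l, shift \<kappa> q j) else 0)
      = (if l = j then if k = i then ?r / ?D else 0 else 0)"
      by (cases "k = i \<and> l = j"; cases "even (i + card a) = even (j + card b)")
        (auto simp: add.commute minus_one_power_iff)
  qed
  also have "\<dots> = ?r"
    using i j by (simp add: sum.delta)
  finally show ?thesis
    using i j by (simp add: even_card_enumeration[OF \<kappa>])
qed

lemma teleport_output_loc_p:
  fixes \<psi> :: "('n::{finite,linorder} set \<times> 'n set) ket"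
  assumes \<kappa>: "basis_enumeration \<kappa>" and \<psi>: "parity_respecting (ketbra \<psi> \<psi>)"
  shows "teleport_output \<kappa> \<psi> (loc_p (ketbra psi_plus psi_plus)) = loc_p (ketbra \<psi> \<psi>)"
    and "teleport_output \<kappa> \<psi> (loc_p_bar (ketbra psi_plus psi_plus)) = loc_p_bar (ketbra \<psi> \<psi>)"
proof -
  \<comment> \<open>For definite total parity, on the support of \<open>\<psi>\<close>, the parities
    of the first system agree exactly when those of the second do.\<close>
  have loc_p: "loc_p (ketbra \<psi> \<psi>) $ (x, a) $ (y, b)
      = (if even (card x) = even (card y) then \<psi> $ (x, a) * cnj (\<psi> $ (y, b)) else 0)" for x a y b
    using definite_parity[OF \<psi>, of "(x, a)" "(y, b)"]
    by (auto simp: loc_p_nth fermion_number_prod_def fermion_number_set_def ketbra_nth)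
  have "teleport_output \<kappa> \<psi> (loc_p (ketbra psi_plus psi_plus)) $ (x, a) $ (y, b)
      = loc_p (ketbra \<psi> \<psi>) $ (x, a) $ (y, b)" for x a y b
    by (subst teleport_output_correlated[OF \<kappa> \<psi>, where c = 1 and c' = 0])
      (auto simp: loc_p loc_p_nth[of "ketbra psi_plus psi_plus"] fermion_number_set_def psi_plus_ketbra_nth)
  then show "teleport_output \<kappa> \<psi> (loc_p (ketbra psi_plus psi_plus)) = loc_p (ketbra \<psi> \<psi>)"
    by (simp add: vec_eq_iff)
  have "teleport_output \<kappa> \<psi> (loc_p_bar (ketbra psi_plus psi_plus)) $ (x, a) $ (y, b)
      = loc_p_bar (ketbra \<psi> \<psi>) $ (x, a) $ (y, b)" for x a y b
    by (subst teleport_output_correlated[OF \<kappa> \<psi>, where c = 0 and c' = 1])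
      (auto simp: loc_p_bar_def loc_p loc_p_nth[of "ketbra psi_plus psi_plus"] fermion_number_set_def
        psi_plus_ketbra_nth ketbra_nth[of \<psi>])
  then show "teleport_output \<kappa> \<psi> (loc_p_bar (ketbra psi_plus psi_plus)) = loc_p_bar (ketbra \<psi> \<psi>)"
    by (simp add: vec_eq_iff)
qed


theorem lemma9:
  fixes \<psi> :: "('n::{finite,linorder} set \<times> 'n set) ket"
    and \<kappa> :: "nat \<Rightarrow> 'n set"
    and \<omega>\<^sub>n\<^sub>o\<^sub>i\<^sub>s\<^sub>e \<omega>\<^sub>A\<^sub>B :: "('n set \<times> 'n set) oper"
    and \<rho>\<^sub>A' :: "'n set oper"
    and F \<Upsilon> \<Upsilon>\<^sub>1 d sg :: real
  assumes d: "d = 2 ^ CARD('n)"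
    and \<kappa>: "basis_enumeration \<kappa>"
    and \<psi>: "fermionic_state (ketbra \<psi> \<psi>)"
    and \<Upsilon>\<^sub>1: "-1 \<le> \<Upsilon>\<^sub>1" "\<Upsilon>\<^sub>1 \<le> 1"
    and \<omega>\<^sub>A\<^sub>B: "\<omega>\<^sub>A\<^sub>B = loc_p (ketbra psi_plus psi_plus) + \<Upsilon> *\<^sub>R loc_p_bar (ketbra psi_plus psi_plus)"
    and \<omega>\<^sub>n\<^sub>o\<^sub>i\<^sub>s\<^sub>e: "\<omega>\<^sub>n\<^sub>o\<^sub>i\<^sub>s\<^sub>e =
      (1 - F) *\<^sub>R ((1 / d\<^sup>2) *\<^sub>R (\<I> \<and>\<^sub>f \<I>) + (\<Upsilon>\<^sub>1 / d\<^sup>2) *\<^sub>R (\<S> \<and>\<^sub>f \<S>)) + F *\<^sub>R \<omega>\<^sub>A\<^sub>B"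
    and state: "fermionic_state \<omega>\<^sub>n\<^sub>o\<^sub>i\<^sub>s\<^sub>e"
    and \<rho>\<^sub>A': "\<rho>\<^sub>A' = ptrace_left (ketbra \<psi> \<psi>)"
    and sg: "sg = (if even_ket \<psi> then 1 else - 1)"
  shows "teleport_output \<kappa> \<psi> \<omega>\<^sub>n\<^sub>o\<^sub>i\<^sub>s\<^sub>e =
      (1 - F) *\<^sub>R ((1 / d) *\<^sub>R (\<I> \<and>\<^sub>f \<rho>\<^sub>A') + (sg * \<Upsilon>\<^sub>1 / d) *\<^sub>R ((\<I> \<and>\<^sub>f \<rho>\<^sub>A') ** (\<S> \<and>\<^sub>f \<S>)))
      + F *\<^sub>R (loc_p (ketbra \<psi> \<psi>) + \<Upsilon> *\<^sub>R loc_p_bar (ketbra \<psi> \<psi>))"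
proof -
  have "sg = 1 \<and> even_ket \<psi> \<or> sg = -1 \<and> odd_ket \<psi>"
    using pure_state_parity[OF \<psi>] sg by auto
  note Sz = teleport_output_Sz[OF \<kappa> this]
  have "parity_respecting (ketbra \<psi> \<psi>)" using \<psi> by (simp add: fermionic_state_def)
  note loc_p = teleport_output_loc_p[OF \<kappa> this]
  have "d \<noteq> 0" by (simp add: d)
  \<comment> \<open>The factors \<open>d\<close> and \<open>sg * d\<close> gained by the two noise
    terms turn their normalisation into that of the output.\<close>
  then have "1 / d\<^sup>2 * d = 1 / d" "\<Upsilon>\<^sub>1 / d\<^sup>2 * (sg * d) = sg * \<Upsilon>\<^sub>1 / d"
    by (simp_all add: power2_eq_square)
  then show ?thesis
    by (simp only: \<omega>\<^sub>n\<^sub>o\<^sub>i\<^sub>s\<^sub>e \<omega>\<^sub>A\<^sub>B teleport_output_add[OF \<kappa>] teleport_output_scaleR[OF \<kappa>] loc_p Sz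
        teleport_output_ident[OF \<kappa>] scaleR_scaleR flip: d \<rho>\<^sub>A')
qed

end
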